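(* Let $I=[-1,1]$, let $n$ be a positive integer and let $u_0,u_1,\dots,u_n$ be real-valued continuous functions on $I$. Let $\mathcal S=\{x_1,\dots,x_s\}\subset I$ be a subset of size $s$ and let $(\varepsilon_1,\dots,\varepsilon_s)\in\{\pm1\}^s$. Suppose there exists a linear combination $P=\sum_{k=0}^n a_k u_k$ (with $a_k\in\mathbb R$) such that (i) the $(n+1)\times s$ generalized Vandermonde matrix $\big(u_k(x_i)\big)_{0\le k\le n,\ 1\le i\le s}$ has full column rank; (ii) $P(x_i)=\varepsilon_i$ for all $i=1,\dots,s$; (iii) $|P(x)|<1$ for all $x\in[-1,1]\setminus\mathcal S$. Then every measure $\sigma=\sum_{i=1}^s\sigma_i\delta_{x_i}$ with $\mathrm{sgn}(\sigma_i)=\varepsilon_i$ for all $i=1,\dots,s$ is the unique solution of generalized minimal extrapolation given the observation $\mathcal K_n(\sigma)$; that is, $\sigma$ is the unique minimizer of $\|\mu\|_{TV}$ over all finite signed measures $\mu$ on $I$ satisfying $\mathcal K_n(\mu)=\mathcal K_n(\sigma)$.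
   Context: For a finite signed (Borel) measure $\mu$ on $I$, the generalized moments are $c_k(\mu)=\int_I u_k\,d\mu$, $k=0,\dots,n$, and $\mathcal K_n(\mu)=(c_0(\mu),\dots,c_n(\mu))$. $\|\mu\|_{TV}$ is the total variation norm. $\delta_x$ is the Dirac measure at $x$. Generalized minimal extrapolation given $\mathcal K_n(\sigma)$ is the problem of minimizing $\|\mu\|_{TV}$ over all finite signed measures $\mu$ on $I$ subject to $\mathcal K_n(\mu)=\mathcal K_n(\sigma)$. *)

theory Defs
  imports "HOL-Probability.Probability" "Jordan_Normal_Form.DL_Rank"
begin

text \<open>
  Finite signed measures on the measurable space \<open>M\<close> (only \<open>space M\<close> and \<open>sets M\<close> matter) are
  countably additive real set functions on \<open>sets M\<close>. As for the library's \<open>measure\<close>, the value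
  outside \<open>sets M\<close> is fixed to be \<open>0\<close>, so that \<open>=\<close> is equality of signed measures.
\<close>

definition finite_signed_measure :: "'a measure \<Rightarrow> ('a set \<Rightarrow> real) \<Rightarrow> bool" where
  "finite_signed_measure M \<mu> \<longleftrightarrow>
     \<mu> {} = 0 \<and>
     (\<forall>A. A \<notin> sets M \<longrightarrow> \<mu> A = 0) \<and>
     (\<forall>A :: nat \<Rightarrow> 'a set. range A \<subseteq> sets M \<longrightarrow> disjoint_family A \<longrightarrow>
        (\<lambda>i. \<mu> (A i)) sums \<mu> (\<Union>i. A i))"

definition tv_norm :: "'a measure \<Rightarrow> ('a set \<Rightarrow> real) \<Rightarrow> ennreal" where
  "tv_norm M \<mu> =
     (SUP \<P> \<in> {\<P>. finite \<P> \<and> \<P> \<subseteq> sets M \<and> partition_on (space M) \<P>}.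
        ennreal (\<Sum>A\<in>\<P>. \<bar>\<mu> A\<bar>))"

text \<open>
  The positive part of the Jordan decomposition, \<open>\<mu>\<^sup>+(A) = sup {\<mu>(B) | B \<subseteq> A measurable}\<close>;
  the negative part is the positive part of \<open>- \<mu>\<close>. The coercion \<open>ennreal\<close> sends negative reals
  to \<open>0\<close>, which does not change the supremum because \<open>B = {}\<close> contributes \<open>0\<close>.
\<close>

definition positive_part :: "'a measure \<Rightarrow> ('a set \<Rightarrow> real) \<Rightarrow> 'a measure" where
  "positive_part M \<mu> =
     measure_of (space M) (sets M) (\<lambda>A. SUP B \<in> {B \<in> sets M. B \<subseteq> A}. ennreal (\<mu> B))"

definition negative_part :: "'a measure \<Rightarrow> ('a set \<Rightarrow> real) \<Rightarrow> 'a measure" where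
  "negative_part M \<mu> = positive_part M (\<lambda>A. - \<mu> A)"

definition signed_integral :: "'a measure \<Rightarrow> ('a set \<Rightarrow> real) \<Rightarrow> ('a \<Rightarrow> real) \<Rightarrow> real" where
  "signed_integral M \<mu> f =
     integral\<^sup>L (positive_part M \<mu>) f - integral\<^sup>L (negative_part M \<mu>) f"

definition borel_I :: "real measure" where
  "borel_I = restrict_space borel {-1..1}"

definition dirac :: "real \<Rightarrow> real set \<Rightarrow> real" where
  "dirac x = measure (return borel_I x)"

definition moments :: "nat \<Rightarrow> (nat \<Rightarrow> real \<Rightarrow> real) \<Rightarrow> (real set \<Rightarrow> real) \<Rightarrow> real vec" where
  "moments n u \<mu> = Matrix.vec (n + 1) (\<lambda>k. signed_integral borel_I \<mu> (u k))"

definition gen_minimal_extrapolation ::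
    "nat \<Rightarrow> (nat \<Rightarrow> real \<Rightarrow> real) \<Rightarrow> real vec \<Rightarrow> (real set \<Rightarrow> real) set" where
  "gen_minimal_extrapolation n u c =
     {\<mu>. finite_signed_measure borel_I \<mu> \<and> moments n u \<mu> = c \<and>
         (\<forall>\<nu>. finite_signed_measure borel_I \<nu> \<and> moments n u \<nu> = c \<longrightarrow>
            tv_norm borel_I \<mu> \<le> tv_norm borel_I \<nu>)}"

definition gen_vandermonde ::
    "nat \<Rightarrow> nat \<Rightarrow> (nat \<Rightarrow> real \<Rightarrow> real) \<Rightarrow> (nat \<Rightarrow> real) \<Rightarrow> real mat" where
  "gen_vandermonde n s u x = Matrix.mat (n + 1) s (\<lambda>(k, i). u k (x i))"

text \<open>The first argument of \<open>vec_space.rank\<close> is the number of rows.\<close>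

definition full_column_rank :: "real mat \<Rightarrow> bool" where
  "full_column_rank A \<longleftrightarrow> vec_space.rank (dim_row A) A = dim_col A"

end

theory Submission
  imports Defs
begin

text \<open>
  \<open>P\<close> is a dual certificate. If \<open>\<nu>\<close> has the same generalized moments as \<open>\<sigma>\<close>, then
  \<open>\<parallel>\<sigma>\<parallel> = \<Sum>\<bar>\<sigma>\<^sub>i\<bar> = \<integral>P d\<sigma> = \<integral>P d\<nu> \<le> \<parallel>\<nu>\<parallel>\<close> because \<open>\<bar>P\<bar> \<le> 1\<close>. In case of equality the gap
  \<open>\<integral>(1 - P) d\<nu>\<^sup>+ + \<integral>(1 + P) d\<nu>\<^sup>-\<close> vanishes, so \<open>\<nu>\<close> lives on \<open>{\<bar>P\<bar> = 1} = S\<close>, and full column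
  rank of the generalized Vandermonde matrix determines its atoms. The Jordan decomposition needs no
  Hahn decomposition: the upper variation is itself a finite measure.
\<close>

section \<open>Elementary properties of finite signed measures\<close>

text \<open>\<open>ennreal\<close> cuts negative terms to 0, so the series on the right sums the
  positive parts of \<open>f\<close>, and these dominate every partial sum of \<open>f\<close>. This
  gives countable subadditivity of the upper variation.\<close>

lemma ennreal_le_suminf_of_sums:
  assumes "f sums s"
  shows "ennreal s \<le> (\<Sum>i. ennreal (f i))"
proof -
  have "ennreal (\<Sum>i<n. f i) \<le> (\<Sum>i. ennreal (f i))" for n
  proof -
    have "ennreal (\<Sum>i<n. f i) \<le> ennreal (\<Sum>i<n. max 0 (f i))"
      by (intro ennreal_leI sum_mono) auto
    also have "\<dots> = (\<Sum>i<n. ennreal (f i))"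
      by (subst sum_ennreal[symmetric]) (auto simp: max_def ennreal_neg simp del: sum_ennreal intro!: sum.cong)
    also have "\<dots> \<le> (\<Sum>i. ennreal (f i))"
      by (rule sum_le_suminf) auto
    finally show ?thesis .
  qed
  then show ?thesis
    using assms unfolding sums_def
    by (intro LIMSEQ_le_const2[OF tendsto_ennrealI]) auto
qed

lemma finite_signed_measure_uminus:
  "finite_signed_measure M \<mu> \<Longrightarrow> finite_signed_measure M (\<lambda>A. - \<mu> A)"
  by (auto simp: finite_signed_measure_def intro!: sums_minus)

lemma finite_signed_measure_weighted_sum:
  assumes "\<And>i. i \<in> I \<Longrightarrow> finite_signed_measure M (\<mu> i)"
  shows "finite_signed_measure M (\<lambda>A. \<Sum>i\<in>I. c i * \<mu> i A)"
  using assms unfolding finite_signed_measure_def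
  by (auto intro!: sums_sum sums_mult)

lemma finite_signed_measure_measure:
  assumes "finite_measure M"
  shows "finite_signed_measure M (measure M)"
  unfolding finite_signed_measure_def
  using finite_measure.finite_measure_UNION[OF assms] by (auto simp: measure_notin_sets)

text \<open>The pair is padded with empty sets to a disjoint sequence; since \<mu> vanishes on the
  empty set, the padding adds nothing.\<close>

lemma signed_measure_Un:
  assumes "finite_signed_measure M \<mu>" "A \<in> sets M" "B \<in> sets M" "A \<inter> B = {}"
  shows "\<mu> (A \<union> B) = \<mu> A + \<mu> B"
proof -
  have "range (binaryset A B) \<subseteq> sets M" "disjoint_family (binaryset A B)"
    using assms by (auto simp: range_binaryset_eq disjoint_family_on_def binaryset_def)
  then have "(\<lambda>i. \<mu> (binaryset A B i)) sums \<mu> (A \<union> B)"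
    using assms(1) unfolding finite_signed_measure_def by (metis UN_binaryset_eq)
  moreover have "(\<lambda>i. \<mu> (binaryset A B i)) sums (\<mu> A + \<mu> B)"
    using assms(1) by (intro binaryset_sums) (auto simp: finite_signed_measure_def)
  ultimately show ?thesis by (rule sums_unique2)
qed

lemma signed_measure_Diff:
  assumes "finite_signed_measure M \<mu>" "A \<in> sets M" "B \<in> sets M" "B \<subseteq> A"
  shows "\<mu> (A - B) = \<mu> A - \<mu> B"
proof -
  have "\<mu> ((A - B) \<union> B) = \<mu> (A - B) + \<mu> B"
    by (rule signed_measure_Un[OF assms(1)]) (use assms in auto)
  then show ?thesis using assms(4) by (simp add: Un_absorb2)
qed

section \<open>Upper variation and Jordan decomposition\<close>

text \<open>The set function inside \<open>positive_part\<close>, studied on its own because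
  \<open>measure_of\<close> has it as its \<open>emeasure\<close> only once countable additivity is
  known.\<close>

definition upper_variation :: "'a measure \<Rightarrow> ('a set \<Rightarrow> real) \<Rightarrow> 'a set \<Rightarrow> ennreal" where
  "upper_variation M \<mu> A = (SUP B \<in> {B \<in> sets M. B \<subseteq> A}. ennreal (\<mu> B))"

lemma upper_variation_upper:
  "B \<in> sets M \<Longrightarrow> B \<subseteq> A \<Longrightarrow> ennreal (\<mu> B) \<le> upper_variation M \<mu> A"
  unfolding upper_variation_def by (rule SUP_upper) auto

lemma upper_variation_empty:
  "\<mu> {} = 0 \<Longrightarrow> upper_variation M \<mu> {} = 0"
  by (auto simp: upper_variation_def cong: conj_cong)

text \<open>Competitors C for A and D for B are disjoint, so their union competes for
  \<open>A \<union> B\<close> with value \<open>\<mu> C + \<mu> D\<close>. The sum of the two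
  suprema is first rewritten as a double supremum.\<close>

lemma upper_variation_superadditive:
  assumes "finite_signed_measure M \<mu>" "A \<in> sets M" "B \<in> sets M" "A \<inter> B = {}"
  shows "upper_variation M \<mu> A + upper_variation M \<mu> B \<le> upper_variation M \<mu> (A \<union> B)"
proof -
  have ne: "{C \<in> sets M. C \<subseteq> X} \<noteq> {}" for X by auto
  have sum_eq: "upper_variation M \<mu> A + upper_variation M \<mu> B =
    (SUP D \<in> {D \<in> sets M. D \<subseteq> B}. SUP C \<in> {C \<in> sets M. C \<subseteq> A}. ennreal (\<mu> C) + ennreal (\<mu> D))"
    unfolding upper_variation_def ennreal_SUP_add_left[OF ne] ennreal_SUP_add_right[OF ne] ..
  have "ennreal (\<mu> C) + ennreal (\<mu> D) \<le> upper_variation M \<mu> (A \<union> B)"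
    if "C \<in> sets M" "C \<subseteq> A" "D \<in> sets M" "D \<subseteq> B" for C D
  proof -
    \<comment> \<open>If \<open>\<mu> C\<close> or \<open>\<mu> D\<close> is negative,
      \<open>ennreal\<close> deletes it and at most one term survives; hence separate bounds for C
      and D beside the one for their union.\<close>
    have "ennreal (\<mu> C) \<le> upper_variation M \<mu> (A \<union> B)" "ennreal (\<mu> D) \<le> upper_variation M \<mu> (A \<union> B)"
      using that by (auto intro!: upper_variation_upper)
    moreover have "ennreal (\<mu> C + \<mu> D) \<le> upper_variation M \<mu> (A \<union> B)"
      using that assms(4) upper_variation_upper[of "C \<union> D" M "A \<union> B" \<mu>]
      by (subst signed_measure_Un[OF assms(1), symmetric]) auto
    ultimately show ?thesis unfolding ennreal_plus_if by (simp split: if_split del: ennreal_plus)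
  qed
  then show ?thesis
    by (auto simp: sum_eq intro!: SUP_least)
qed

text \<open>Superadditivity bounds all partial sums, which gives one inequality. For the other, a
  measurable B inside the union is cut into the pieces \<open>B \<inter> A i\<close>.\<close>

lemma upper_variation_countably_additive:
  assumes \<mu>: "finite_signed_measure M \<mu>"
  shows "countably_additive (sets M) (upper_variation M \<mu>)"
  unfolding countably_additive_def
proof (intro allI impI antisym)
  fix A :: "nat \<Rightarrow> 'a set"
  assume A: "range A \<subseteq> sets M" "disjoint_family A" "(\<Union>i. A i) \<in> sets M"
  have finite_sum: "(\<Sum>i<k. upper_variation M \<mu> (A i)) \<le> upper_variation M \<mu> (\<Union>i<k. A i)" for k
  proof (induction k)
    case 0
    then show ?case by simp
  next
    case (Suc k)
    have "(\<Union>i<k. A i) \<inter> A k = {}"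
      using A(2) by (auto simp: disjoint_family_on_def dest: less_imp_neq)
    have "(\<Sum>i<Suc k. upper_variation M \<mu> (A i))
        \<le> upper_variation M \<mu> (\<Union>i<k. A i) + upper_variation M \<mu> (A k)"
      using Suc by (simp add: add_right_mono)
    also have "\<dots> \<le> upper_variation M \<mu> ((\<Union>i<k. A i) \<union> A k)"
      using A(1) \<open>(\<Union>i<k. A i) \<inter> A k = {}\<close>
      by (intro upper_variation_superadditive[OF \<mu>]) auto
    finally show ?case by (simp add: lessThan_Suc Un_commute)
  qed
  show "(\<Sum>i. upper_variation M \<mu> (A i)) \<le> upper_variation M \<mu> (\<Union>i. A i)"
  proof (rule suminf_le_const)
    fix k
    have "upper_variation M \<mu> (\<Union>i<k. A i) \<le> upper_variation M \<mu> (\<Union>i. A i)"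
      unfolding upper_variation_def by (intro SUP_subset_mono) auto
    with finite_sum show "(\<Sum>i<k. upper_variation M \<mu> (A i)) \<le> upper_variation M \<mu> (\<Union>i. A i)"
      by (rule order_trans)
  qed simp
  show "upper_variation M \<mu> (\<Union>i. A i) \<le> (\<Sum>i. upper_variation M \<mu> (A i))"
    unfolding upper_variation_def[of M \<mu> "\<Union>i. A i"]
  proof (rule SUP_least)
    fix B assume "B \<in> {B \<in> sets M. B \<subseteq> (\<Union>i. A i)}"
    then have B: "B \<in> sets M" "(\<Union>i. B \<inter> A i) = B" by auto
    have "range (\<lambda>i. B \<inter> A i) \<subseteq> sets M" "disjoint_family (\<lambda>i. B \<inter> A i)"
      using A B by (auto simp: disjoint_family_on_def)
    then have "(\<lambda>i. \<mu> (B \<inter> A i)) sums \<mu> B"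
      using \<mu> B(2) unfolding finite_signed_measure_def by metis
    then have "ennreal (\<mu> B) \<le> (\<Sum>i. ennreal (\<mu> (B \<inter> A i)))"
      by (rule ennreal_le_suminf_of_sums)
    also have "\<dots> \<le> (\<Sum>i. upper_variation M \<mu> (A i))"
      using A(1) B(1) by (intro suminf_le upper_variation_upper) auto
    finally show "ennreal (\<mu> B) \<le> (\<Sum>i. upper_variation M \<mu> (A i))" .
  qed
qed

lemma emeasure_positive_part:
  assumes "finite_signed_measure M \<mu>" "A \<in> sets M"
  shows "emeasure (positive_part M \<mu>) A = upper_variation M \<mu> A"
  unfolding positive_part_def upper_variation_def[symmetric]
  using assms upper_variation_countably_additive[OF assms(1)]
  by (intro emeasure_measure_of_sigma sets.sigma_algebra_axioms)
     (auto simp: positive_def upper_variation_empty finite_signed_measure_def)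

lemma sets_positive_part [simp, measurable_cong]: "sets (positive_part M \<mu>) = sets M"
  by (simp add: positive_part_def)

lemma space_positive_part [simp]: "space (positive_part M \<mu>) = space M"
  by (simp add: positive_part_def)

lemma upper_variation_split:
  assumes "finite_signed_measure M \<mu>" "A \<in> sets M" "B \<in> sets M" "B \<subseteq> A"
  shows "upper_variation M \<mu> A = upper_variation M \<mu> B + upper_variation M \<mu> (A - B)"
  using plus_emeasure[of B "positive_part M \<mu>" "A - B"] assms
  by (simp add: emeasure_positive_part Un_absorb1)

text \<open>
  A set of infinite upper variation contains one again after removal of a set of measure at least
  \<open>1\<close> in absolute value. Iterating this would yield a disjoint sequence whose measures do not sum.
\<close>

lemma upper_variation_finite:
  assumes \<mu>: "finite_signed_measure M \<mu>" and "A \<in> sets M"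
  shows "upper_variation M \<mu> A \<noteq> \<infinity>"
proof
  assume inf: "upper_variation M \<mu> A = \<infinity>"
  define Q where "Q E \<longleftrightarrow> E \<in> sets M \<and> upper_variation M \<mu> E = \<infinity>" for E
  have step: "\<exists>E'. Q E' \<and> E' \<subseteq> E \<and> 1 \<le> \<bar>\<mu> (E - E')\<bar>" if "Q E" for E
  proof -
    have E: "E \<in> sets M" "upper_variation M \<mu> E = \<infinity>" using that by (auto simp: Q_def)
    \<comment> \<open>The threshold makes both halves large:
      \<open>\<mu> B > 1 + \<bar>\<mu> E\<bar>\<close> also forces
      \<open>\<bar>\<mu> (E - B)\<bar> \<ge> 1\<close>. One of the halves has infinite upper
      variation and is kept, the other is removed.\<close>
    have "ennreal (1 + \<bar>\<mu> E\<bar>) < upper_variation M \<mu> E" using E by simp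
    then obtain B where B: "B \<in> sets M" "B \<subseteq> E" "ennreal (1 + \<bar>\<mu> E\<bar>) < ennreal (\<mu> B)"
      unfolding upper_variation_def less_SUP_iff by auto
    then have "1 + \<bar>\<mu> E\<bar> < \<mu> B" by (subst (asm) ennreal_less_iff) auto
    then have "1 \<le> \<bar>\<mu> B\<bar>" "1 \<le> \<bar>\<mu> (E - B)\<bar>"
      using signed_measure_Diff[OF \<mu> E(1) B(1,2)] by auto
    moreover have "E - (E - B) = B" using B by auto
    moreover have "Q B \<or> Q (E - B)"
      using upper_variation_split[OF \<mu> E(1) B(1,2)] E B by (simp add: Q_def) (metis ennreal_add_eq_top)
    ultimately show ?thesis using B(2) by (metis Diff_subset)
  qed
  obtain E where E: "\<And>n. Q (E n)" "\<And>n. E (Suc n) \<subseteq> E n" "\<And>n. 1 \<le> \<bar>\<mu> (E n - E (Suc n))\<bar>"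
    using dependent_nat_choice[of "\<lambda>_. Q" "\<lambda>_ E E'. E' \<subseteq> E \<and> 1 \<le> \<bar>\<mu> (E - E')\<bar>"] step inf assms(2)
    unfolding Q_def by metis
  define D where "D n = E n - E (Suc n)" for n
  have dec: "decseq E" using E(2) by (rule decseq_SucI)
  have "D m \<inter> D n = {}" if "m < n" for m n
    using decseqD[OF dec, of "Suc m" n] that by (auto simp: D_def)
  then have "disjoint_family D"
    unfolding disjoint_family_on_def by (metis Int_commute nat_neq_iff)
  moreover have "range D \<subseteq> sets M" using E(1) by (auto simp: D_def Q_def)
  ultimately have "(\<lambda>n. \<mu> (D n)) sums \<mu> (\<Union>n. D n)"
    using \<mu> unfolding finite_signed_measure_def by blast
  then have "(\<lambda>n. \<mu> (D n)) \<longlonglongrightarrow> 0" by (intro summable_LIMSEQ_zero) (rule sums_summable)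
  then have "\<forall>\<^sub>F n in sequentially. \<bar>\<mu> (D n)\<bar> < 1"
    by (auto dest: order_tendstoD(2)[OF tendsto_rabs_zero, of _ _ 1])
  then show False using E(3) by (auto simp: D_def eventually_sequentially not_less[symmetric])
qed

lemma finite_measure_positive_part:
  "finite_signed_measure M \<mu> \<Longrightarrow> finite_measure (positive_part M \<mu>)"
  by (rule finite_measureI) (simp add: emeasure_positive_part upper_variation_finite[unfolded infinity_ennreal_def])

text \<open>Together with the next lemma this expresses in real numbers that the positive part is a
  least upper bound; its values are handled through these two facts from here on.\<close>

lemma measure_positive_part_ge:
  assumes "finite_signed_measure M \<mu>" "A \<in> sets M" "B \<in> sets M" "B \<subseteq> A"
  shows "\<mu> B \<le> measure (positive_part M \<mu>) A"
proof -
  interpret finite_measure "positive_part M \<mu>" using assms(1) by (rule finite_measure_positive_part)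
  have "ennreal (\<mu> B) \<le> ennreal (measure (positive_part M \<mu>) A)"
    using upper_variation_upper[OF assms(3,4)] assms(1,2)
    by (simp add: emeasure_eq_measure[symmetric] emeasure_positive_part)
  then show ?thesis by (simp add: ennreal_le_iff)
qed

lemma measure_positive_part_le:
  assumes "finite_signed_measure M \<mu>" "A \<in> sets M"
    and "\<And>B. B \<in> sets M \<Longrightarrow> B \<subseteq> A \<Longrightarrow> \<mu> B \<le> c"
  shows "measure (positive_part M \<mu>) A \<le> c"
proof -
  \<comment> \<open>The empty set supplies the sign; for negative c, \<open>ennreal c\<close> would
    be 0 and the bound would be lost.\<close>
  have "0 \<le> c" using assms(1) assms(3)[of "{}"] by (auto simp: finite_signed_measure_def)
  have "emeasure (positive_part M \<mu>) A \<le> ennreal c"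
    unfolding emeasure_positive_part[OF assms(1,2)] upper_variation_def
    using assms(3) by (intro SUP_least ennreal_leI) auto
  then show ?thesis using \<open>0 \<le> c\<close> by (simp add: measure_def enn2real_leI)
qed

text \<open>For B inside A, \<open>\<mu> B = \<mu> A - \<mu> (A - B)\<close>, and
  \<open>- \<mu> (A - B)\<close> is bounded by the negative part of A. The supremum over B gives one
  inequality; exchanging \<mu> and its negative gives the other.\<close>

lemma jordan_decomposition:
  assumes \<mu>: "finite_signed_measure M \<mu>" and A: "A \<in> sets M"
  shows "\<mu> A = measure (positive_part M \<mu>) A - measure (negative_part M \<mu>) A"
proof -
  note \<mu>' = finite_signed_measure_uminus[OF \<mu>]
  have "\<mu> B \<le> \<mu> A + measure (negative_part M \<mu>) A" if "B \<in> sets M" "B \<subseteq> A" for B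
    using measure_positive_part_ge[OF \<mu>' A, of "A - B"] signed_measure_Diff[OF \<mu> A that] A that
    by (simp add: negative_part_def)
  then have "measure (positive_part M \<mu>) A \<le> \<mu> A + measure (negative_part M \<mu>) A"
    by (rule measure_positive_part_le[OF \<mu> A])
  moreover have "- \<mu> B \<le> measure (positive_part M \<mu>) A - \<mu> A" if "B \<in> sets M" "B \<subseteq> A" for B
    using measure_positive_part_ge[OF \<mu> A, of "A - B"] signed_measure_Diff[OF \<mu> A that] A that
    by simp
  then have "measure (negative_part M \<mu>) A \<le> measure (positive_part M \<mu>) A - \<mu> A"
    unfolding negative_part_def by (rule measure_positive_part_le[OF \<mu>' A])
  ultimately show ?thesis by simp
qed

lemma sets_negative_part [simp, measurable_cong]: "sets (negative_part M \<mu>) = sets M"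
  by (simp add: negative_part_def)

lemma space_negative_part [simp]: "space (negative_part M \<mu>) = space M"
  by (simp add: negative_part_def)

lemma finite_measure_negative_part:
  "finite_signed_measure M \<mu> \<Longrightarrow> finite_measure (negative_part M \<mu>)"
  unfolding negative_part_def
  by (intro finite_measure_positive_part finite_signed_measure_uminus)

text \<open>Partitions into B and its complement suffice. If the norm is t, they give
  \<open>2 * \<mu> B \<le> t + \<mu> (space M)\<close>; the supremum over B yields
  \<open>2 * p \<le> t + p - q\<close>, that is \<open>p + q \<le> t\<close>, for the masses p and q
  of the Jordan parts.\<close>

lemma jordan_parts_le_tv_norm:
  assumes \<mu>: "finite_signed_measure M \<mu>"
  shows "ennreal (measure (positive_part M \<mu>) (space M) + measure (negative_part M \<mu>) (space M))
    \<le> tv_norm M \<mu>" (is "ennreal (?p + ?q) \<le> _")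
proof (cases "tv_norm M \<mu>")
  case (real t)
  have jordan: "\<mu> (space M) = ?p - ?q" using \<mu> by (rule jordan_decomposition) simp
  have "\<mu> B \<le> (t + \<mu> (space M)) / 2" if B: "B \<in> sets M" "B \<subseteq> space M" for B
  proof -
    \<comment> \<open>\<open>partition_on\<close> forbids empty blocks. Dropping them leaves the sum
      unchanged because \<mu> is 0 on the empty set.\<close>
    let ?\<P> = "{B, space M - B} - {{}}"
    have "partition_on (space M) ?\<P>"
      using B by (auto simp: partition_on_def disjoint_def)
    then have "ennreal (\<Sum>A\<in>?\<P>. \<bar>\<mu> A\<bar>) \<le> tv_norm M \<mu>"
      unfolding tv_norm_def using B by (intro SUP_upper) auto
    moreover have "(\<Sum>A\<in>?\<P>. \<bar>\<mu> A\<bar>) = \<bar>\<mu> B\<bar> + \<bar>\<mu> (space M - B)\<bar>"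
    proof -
      have "(\<Sum>A\<in>?\<P>. \<bar>\<mu> A\<bar>) = (\<Sum>A\<in>{B, space M - B}. \<bar>\<mu> A\<bar>)"
        using \<mu> by (intro sum.mono_neutral_left) (auto simp: finite_signed_measure_def)
      \<comment> \<open>The two blocks coincide only if both are empty, so no nonzero term is lost
        by forming a set of them.\<close>
      moreover have "B = space M - B \<Longrightarrow> B = {}" by blast
      ultimately show ?thesis
        using \<mu> by (cases "B = space M - B") (auto simp: finite_signed_measure_def)
    qed
    ultimately have "\<bar>\<mu> B\<bar> + \<bar>\<mu> (space M - B)\<bar> \<le> t" using real by (simp add: ennreal_le_iff del: ennreal_plus)
    then show ?thesis using signed_measure_Diff[OF \<mu> sets.top B] by (simp add: field_simps)
  qed
  then have "?p \<le> (t + \<mu> (space M)) / 2" by (rule measure_positive_part_le[OF \<mu> sets.top])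
  then show ?thesis using jordan real by (auto simp: field_simps simp del: ennreal_plus intro!: ennreal_leI)
qed simp

section \<open>Measures concentrated on a finite set\<close>

text \<open>Off a null set, \<open>f\<close> agrees with the finite combination of indicators of the
  points of S weighted by the values of \<open>f\<close>.\<close>

lemma integral_concentrated:
  fixes f :: "'a \<Rightarrow> real"
  assumes "finite_measure N" "finite S" "\<And>y. y \<in> S \<Longrightarrow> {y} \<in> sets N"
    and "measure N (space N - S) = 0" and [measurable]: "f \<in> borel_measurable N"
  shows "integral\<^sup>L N f = (\<Sum>y\<in>S. f y * measure N {y})"
proof -
  interpret finite_measure N by fact
  have "(\<Union>y\<in>S. {y}) \<in> sets N" using assms(2,3) by (intro sets.finite_UN) auto
  then have S: "S \<in> sets N" by simp
  have "space N - S \<in> null_sets N" using S assms(4) by (auto intro!: null_setsI simp: emeasure_eq_measure)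
  then have "AE y in N. y \<notin> space N - S" by (rule AE_not_in)
  then have "AE y in N. f y = (\<Sum>z\<in>S. f z * indicator {z} y)"
    by (rule AE_mp)
       (auto intro!: AE_I2 simp: indicator_def of_bool_def if_distrib sum.delta'[OF assms(2)] cong: if_cong)
  then have "integral\<^sup>L N f = (\<integral>y. (\<Sum>z\<in>S. f z * indicator {z} y) \<partial>N)"
    using assms(3) by (intro integral_cong_AE) auto
  also have "\<dots> = (\<Sum>z\<in>S. f z * measure N {z})"
    using assms(3) by (subst Bochner_Integration.integral_sum) (auto simp: emeasure_eq_measure)
  finally show ?thesis .
qed

text \<open>Since \<mu> vanishes on every measurable set off S, and not just on the complement as a
  whole, no cancellation can hide mass there: both Jordan parts are null off S.\<close>

lemma signed_integral_concentrated:
  assumes \<mu>: "finite_signed_measure M \<mu>"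
    and S: "finite S" "\<And>y. y \<in> S \<Longrightarrow> {y} \<in> sets M"
    and zero: "\<And>B. B \<in> sets M \<Longrightarrow> B \<inter> S = {} \<Longrightarrow> \<mu> B = 0"
    and f: "f \<in> borel_measurable M"
  shows "signed_integral M \<mu> f = (\<Sum>y\<in>S. f y * \<mu> {y})"
proof -
  have "(\<Union>y\<in>S. {y}) \<in> sets M" using S by (intro sets.finite_UN) auto
  then have C: "space M - S \<in> sets M" by auto
  have null: "measure (positive_part M \<kappa>) (space M - S) = 0"
    if "finite_signed_measure M \<kappa>" "\<And>B. B \<in> sets M \<Longrightarrow> B \<inter> S = {} \<Longrightarrow> \<kappa> B = 0" for \<kappa>
  proof (rule antisym)
    show "measure (positive_part M \<kappa>) (space M - S) \<le> 0"
      by (rule measure_positive_part_le[OF that(1) C]) (use that(2) in \<open>fastforce intro: eq_refl\<close>)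
  qed simp
  have "integral\<^sup>L (positive_part M \<mu>) f = (\<Sum>y\<in>S. f y * measure (positive_part M \<mu>) {y})"
    using null[OF \<mu> zero] S f
    by (intro integral_concentrated finite_measure_positive_part \<mu>) auto
  moreover have "integral\<^sup>L (negative_part M \<mu>) f = (\<Sum>y\<in>S. f y * measure (negative_part M \<mu>) {y})"
    using null[OF finite_signed_measure_uminus[OF \<mu>]] zero S f
    by (intro integral_concentrated finite_measure_negative_part \<mu>) (auto simp: negative_part_def)
  ultimately show ?thesis
    using jordan_decomposition[OF \<mu>] S(2)
    by (simp add: signed_integral_def sum_subtractf[symmetric] right_diff_distrib[symmetric])
qed

text \<open>Integrating the indicator of A recovers \<open>\<mu> A\<close>.\<close>

lemma signed_measure_concentrated:
  assumes "finite_signed_measure M \<mu>" "finite S" "\<And>y. y \<in> S \<Longrightarrow> {y} \<in> sets M"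
    and "\<And>B. B \<in> sets M \<Longrightarrow> B \<inter> S = {} \<Longrightarrow> \<mu> B = 0" and A: "A \<in> sets M"
  shows "\<mu> A = (\<Sum>y\<in>S. indicator A y * \<mu> {y})"
proof -
  have "\<mu> A = signed_integral M \<mu> (indicator A)"
    using A sets.sets_into_space[OF A] jordan_decomposition[OF assms(1) A]
    by (simp add: signed_integral_def Int_absorb2)
  also have "\<dots> = (\<Sum>y\<in>S. indicator A y * \<mu> {y})"
    using assms(1-4) borel_measurable_indicator[OF A] by (rule signed_integral_concentrated)
  finally show ?thesis .
qed

section \<open>Weak duality and its equality case\<close>

lemma signed_integral_linear_combination:
  assumes "\<And>k. k \<in> K \<Longrightarrow> integrable (positive_part M \<mu>) (u k)"
    and "\<And>k. k \<in> K \<Longrightarrow> integrable (negative_part M \<mu>) (u k)"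
  shows "signed_integral M \<mu> (\<lambda>t. \<Sum>k\<in>K. a k * u k t) = (\<Sum>k\<in>K. a k * signed_integral M \<mu> (u k))"
  using assms by (simp add: signed_integral_def sum_subtractf right_diff_distrib)

text \<open>
  Weak duality as an identity: with \<open>p\<close> and \<open>q\<close> the masses of the Jordan parts,
  \<open>p + q - \<integral>f d\<mu> = \<integral>(1 - f) d\<mu>\<^sup>+ + \<integral>(1 + f) d\<mu>\<^sup>-\<close>.
\<close>

lemma duality_gap:
  assumes \<mu>: "finite_signed_measure M \<mu>" and f: "f \<in> borel_measurable M"
    and bound: "\<And>y. y \<in> space M \<Longrightarrow> \<bar>f y\<bar> \<le> 1"
  shows "integrable (positive_part M \<mu>) f" "integrable (negative_part M \<mu>) f"
    and "measure (positive_part M \<mu>) (space M) + measure (negative_part M \<mu>) (space M)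
      - signed_integral M \<mu> f
      = (\<integral>y. 1 - f y \<partial>positive_part M \<mu>) + (\<integral>y. 1 + f y \<partial>negative_part M \<mu>)"
proof -
  interpret p: finite_measure "positive_part M \<mu>" by (rule finite_measure_positive_part[OF \<mu>])
  interpret q: finite_measure "negative_part M \<mu>" by (rule finite_measure_negative_part[OF \<mu>])
  show i: "integrable (positive_part M \<mu>) f" "integrable (negative_part M \<mu>) f"
    using f bound
    by (auto intro!: p.integrable_const_bound[of _ 1] q.integrable_const_bound[of _ 1])
  show "measure (positive_part M \<mu>) (space M) + measure (negative_part M \<mu>) (space M)
      - signed_integral M \<mu> f
      = (\<integral>y. 1 - f y \<partial>positive_part M \<mu>) + (\<integral>y. 1 + f y \<partial>negative_part M \<mu>)"
    using i by (simp add: signed_integral_def)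
qed

lemma signed_integral_le_tv_norm:
  assumes "finite_signed_measure M \<mu>" "f \<in> borel_measurable M"
    and "\<And>y. y \<in> space M \<Longrightarrow> \<bar>f y\<bar> \<le> 1"
  shows "ennreal (signed_integral M \<mu> f) \<le> tv_norm M \<mu>"
proof -
  have "0 \<le> (\<integral>y. 1 - f y \<partial>positive_part M \<mu>)" "0 \<le> (\<integral>y. 1 + f y \<partial>negative_part M \<mu>)"
    using assms(3) by (auto intro!: Bochner_Integration.integral_nonneg simp: abs_le_iff) force
  then have "signed_integral M \<mu> f
    \<le> measure (positive_part M \<mu>) (space M) + measure (negative_part M \<mu>) (space M)"
    using duality_gap(3)[OF assms] by simp
  then show ?thesis
    using jordan_parts_le_tv_norm[OF assms(1)] by (blast intro: ennreal_leI order_trans)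
qed

text \<open>With zero gap, \<open>f\<close> is 1 almost everywhere for the positive part and -1
  almost everywhere for the negative part, so a set where \<open>\<bar>f\<bar> < 1\<close> is null
  for both.\<close>

lemma signed_measure_eq_0_if_tv_norm_attained:
  assumes \<mu>: "finite_signed_measure M \<mu>" and f [measurable]: "f \<in> borel_measurable M"
    and bound: "\<And>y. y \<in> space M \<Longrightarrow> \<bar>f y\<bar> \<le> 1"
    and tv: "tv_norm M \<mu> \<le> ennreal (signed_integral M \<mu> f)" "0 \<le> signed_integral M \<mu> f"
    and B: "B \<in> sets M" "\<And>y. y \<in> B \<Longrightarrow> \<bar>f y\<bar> < 1"
  shows "\<mu> B = 0"
proof -
  let ?N = "positive_part M \<mu>" and ?N' = "negative_part M \<mu>"
  interpret p: finite_measure ?N by (rule finite_measure_positive_part[OF \<mu>])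
  interpret q: finite_measure ?N' by (rule finite_measure_negative_part[OF \<mu>])
  note i = duality_gap(1,2)[OF \<mu> f bound]
  \<comment> \<open>Nonnegativity of the integral lets the \<open>ennreal\<close> bound be read in
    the reals, without truncation.\<close>
  have "measure ?N (space M) + measure ?N' (space M) \<le> signed_integral M \<mu> f"
    using order_trans[OF jordan_parts_le_tv_norm[OF \<mu>] tv(1)] tv(2)
    by (simp add: ennreal_le_iff del: ennreal_plus)
  then have le: "(\<integral>y. 1 - f y \<partial>?N) + (\<integral>y. 1 + f y \<partial>?N') \<le> 0"
    using duality_gap(3)[OF \<mu> f bound] by simp
  have nn: "0 \<le> 1 - f y" "0 \<le> 1 + f y" if "y \<in> space M" for y
    using bound[OF that] by (auto simp: abs_le_iff)
  have "0 \<le> (\<integral>y. 1 - f y \<partial>?N)" "0 \<le> (\<integral>y. 1 + f y \<partial>?N')"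
    using nn by (auto intro!: Bochner_Integration.integral_nonneg)
  with le have "(\<integral>y. 1 - f y \<partial>?N) = 0" "(\<integral>y. 1 + f y \<partial>?N') = 0" by auto
  then have "AE y in ?N. 1 - f y = 0" "AE y in ?N'. 1 + f y = 0"
    using i nn
    by (intro integral_nonneg_eq_0_iff_AE[THEN iffD1]; auto simp del: integral_diff integral_add)+
  then have "AE y in ?N. y \<notin> B" "AE y in ?N'. y \<notin> B"
    using B(2) by (force elim!: eventually_mono)+
  then have "B \<in> null_sets ?N" "B \<in> null_sets ?N'" using B(1) by (auto simp: AE_iff_null_sets)
  then have "measure ?N B = 0" "measure ?N' B = 0" by (auto simp: measure_eq_0_null_sets)
  then show ?thesis using jordan_decomposition[OF \<mu> B(1)] by simp
qed

section \<open>Full column rank and injectivity\<close>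

text \<open>Rank is governed by the set of columns, so repeated columns must be excluded before a
  kernel vector contradicts linear independence.\<close>

lemma mult_mat_vec_eq_zero_of_full_column_rank:
  assumes "A \<in> carrier_mat m k" "full_column_rank A" "v \<in> carrier_vec k" "A *\<^sub>v v = 0\<^sub>v m"
  shows "v = 0\<^sub>v k"
proof (rule ccontr)
  assume nz: "v \<noteq> 0\<^sub>v k"
  interpret vec_space "TYPE(real)" m .
  have rank: "rank A = k" using assms(1,2) by (simp add: full_column_rank_def)
  \<comment> \<open>A maximal independent set of columns has k elements, so the list of k columns
    has at least k different entries and hence no repetition.\<close>
  obtain U where U: "maximal U (\<lambda>T. T \<subseteq> set (cols A) \<and> lin_indpt T)"
    using maximal_exists[of "(\<lambda>T. T \<subseteq> set (cols A) \<and> lin_indpt T)" "card (set (cols A))" "{}"]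
    by (meson List.finite_set card_mono empty_iff empty_subsetI finite_lin_indpt2 rev_finite_subset)
  then have "k \<le> card (set (cols A))"
    using rank rank_card_indpt[OF assms(1) U] by (auto simp: maximal_def intro: card_mono)
  then have "distinct (cols A)"
    using assms(1) card_length[of "cols A"] by (intro card_distinct) auto
  then show False
    using lin_depI[OF assms(1,3) nz assms(4)] full_rank_lin_indpt[OF assms(1) rank] by blast
qed

text \<open>The difference of the two weight vectors lies in the kernel of the matrix.\<close>

lemma gen_vandermonde_injective:
  assumes "full_column_rank (gen_vandermonde n s u x)"
    and "\<And>k. k \<le> n \<Longrightarrow> (\<Sum>i<s. c i * u k (x i)) = (\<Sum>i<s. d i * u k (x i))"
    and "i < s"
  shows "c i = d i"
proof -
  let ?A = "gen_vandermonde n s u x" and ?v = "Matrix.vec s (\<lambda>i. c i - d i)"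
  have A: "?A \<in> carrier_mat (n + 1) s" by (simp add: gen_vandermonde_def)
  have "?A *\<^sub>v ?v = 0\<^sub>v (n + 1)"
  proof (rule eq_vecI)
    fix k assume "k < dim_vec (0\<^sub>v (n + 1) :: real vec)"
    then have k: "k \<le> n" by simp
    then have "(?A *\<^sub>v ?v) $ k = (\<Sum>i<s. u k (x i) * (c i - d i))"
      by (simp add: gen_vandermonde_def scalar_prod_def lessThan_atLeast0)
    also have "\<dots> = 0"
      using assms(2)[OF k] by (simp add: algebra_simps sum_subtractf)
    finally show "(?A *\<^sub>v ?v) $ k = 0\<^sub>v (n + 1) $ k" using k by simp
  qed (simp add: gen_vandermonde_def)
  then have "?v = 0\<^sub>v s"
    using mult_mat_vec_eq_zero_of_full_column_rank[OF A assms(1)] by simp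
  then have "?v $ i = 0" using assms(3) by simp
  then show ?thesis using assms(3) by simp
qed

section \<open>Continuous functions and Dirac measures on the interval\<close>

lemma space_borel_I [simp]: "space borel_I = {-1..1}"
  by (simp add: borel_I_def space_restrict_space)

lemma singleton_sets_borel_I: "y \<in> {-1..1} \<Longrightarrow> {y} \<in> sets borel_I"
  by (auto simp: borel_I_def sets_restrict_space_iff)

lemma borel_measurable_borel_I:
  "continuous_on {-1..1} f \<Longrightarrow> f \<in> borel_measurable borel_I"
  unfolding borel_I_def by (rule borel_measurable_continuous_on_restrict)

text \<open>Compactness of the interval bounds \<open>f\<close>, and bounded measurable functions
  are integrable for finite measures. This serves the single functions \<open>u k\<close>, so that
  the integral of P can be split.\<close>

lemma integrable_borel_I:
  fixes f :: "real \<Rightarrow> real"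
  assumes "continuous_on {-1..1} f" "finite_measure N" "sets N = sets borel_I"
  shows "integrable N f"
proof -
  interpret finite_measure N by fact
  have "bounded (f ` {-1..1})"
    using assms(1) by (intro compact_imp_bounded compact_continuous_image) auto
  then obtain b where "\<And>t. t \<in> {-1..1} \<Longrightarrow> norm (f t) \<le> b" unfolding bounded_iff by blast
  moreover have "f \<in> borel_measurable N"
    using borel_measurable_borel_I[OF assms(1)] measurable_cong_sets[OF assms(3) refl] by blast
  ultimately show ?thesis
    using sets_eq_imp_space_eq[OF assms(3)] by (auto intro!: integrable_const_bound[of _ b])
qed

lemma dirac_eq:
  "dirac y A = (if A \<in> sets borel_I then indicator A y else 0)"
  by (simp add: dirac_def measure_return measure_notin_sets)

lemma finite_measure_return: "y \<in> space M \<Longrightarrow> finite_measure (return M y)"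
  by (intro prob_space.finite_measure prob_space_return)

lemma finite_signed_measure_dirac:
  assumes "y \<in> {-1..1}"
  shows "finite_signed_measure borel_I (dirac y)"
proof -
  \<comment> \<open>\<open>finite_signed_measure\<close> sees its space only through
    \<open>sets\<close>, which \<open>return\<close> leaves unchanged.\<close>
  have "finite_signed_measure (return borel_I y) (dirac y)"
    unfolding dirac_def
    using assms by (intro finite_signed_measure_measure finite_measure_return) simp
  then show ?thesis by (simp add: finite_signed_measure_def)
qed

text \<open>By the triangle inequality, since each Dirac measure gives disjoint blocks total mass at
  most 1.\<close>

lemma tv_norm_dirac_sum_le:
  assumes "\<And>i. i \<in> J \<Longrightarrow> x i \<in> {-1..1}"
  shows "tv_norm borel_I (\<lambda>A. \<Sum>i\<in>J. c i * dirac (x i) A) \<le> ennreal (\<Sum>i\<in>J. \<bar>c i\<bar>)"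
  unfolding tv_norm_def
proof (rule SUP_least, rule ennreal_leI)
  fix \<P> assume "\<P> \<in> {\<P>. finite \<P> \<and> \<P> \<subseteq> sets borel_I \<and> partition_on (space borel_I) \<P>}"
  then have P: "finite \<P>" "\<P> \<subseteq> sets borel_I" "disjoint \<P>" by (auto simp: partition_on_def)
  have one: "(\<Sum>A\<in>\<P>. dirac (x i) A) \<le> 1" if "i \<in> J" for i
  proof -
    interpret prob_space "return borel_I (x i)" using assms[OF that] by (intro prob_space_return) simp
    have "(\<Sum>A\<in>\<P>. dirac (x i) A) = prob (\<Union>A\<in>\<P>. A)"
      unfolding dirac_def using P
      by (intro finite_measure_finite_Union[symmetric])
         (auto simp: disjoint_family_on_def disjoint_def)
    then show ?thesis by simp
  qed
  have "(\<Sum>A\<in>\<P>. \<bar>\<Sum>i\<in>J. c i * dirac (x i) A\<bar>) \<le> (\<Sum>A\<in>\<P>. \<Sum>i\<in>J. \<bar>c i\<bar> * dirac (x i) A)"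
    by (intro sum_mono order_trans[OF sum_abs]) (auto simp: abs_mult dirac_def)
  also have "\<dots> = (\<Sum>i\<in>J. \<bar>c i\<bar> * (\<Sum>A\<in>\<P>. dirac (x i) A))"
    by (subst sum.swap) (simp add: sum_distrib_left)
  also have "\<dots> \<le> (\<Sum>i\<in>J. \<bar>c i\<bar> * 1)" using one by (intro sum_mono mult_left_mono) auto
  finally show "(\<Sum>A\<in>\<P>. \<bar>\<Sum>i\<in>J. c i * dirac (x i) A\<bar>) \<le> (\<Sum>i\<in>J. \<bar>c i\<bar>)" by simp
qed

section \<open>Optimality and uniqueness of the atomic measure\<close>

theorem lemma1p1:
  fixes n s :: nat
    and u :: "nat \<Rightarrow> real \<Rightarrow> real"
    and x \<epsilon> a \<sigma> :: "nat \<Rightarrow> real"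
    and P :: "real \<Rightarrow> real"
    and S :: "real set"
  assumes "n \<ge> 1"
    and "\<And>k. k \<le> n \<Longrightarrow> continuous_on {-1..1} (u k)"
    and "inj_on x {..<s}"
    and "S = x ` {..<s}"
    and "S \<subseteq> {-1..1}"
    and "\<And>i. i < s \<Longrightarrow> \<epsilon> i \<in> {-1, 1}"
    and "P = (\<lambda>t. \<Sum>k\<le>n. a k * u k t)"
    and "full_column_rank (gen_vandermonde n s u x)"
    and "\<And>i. i < s \<Longrightarrow> P (x i) = \<epsilon> i"
    and "\<And>t. t \<in> {-1..1} - S \<Longrightarrow> \<bar>P t\<bar> < 1"
    and "\<And>i. i < s \<Longrightarrow> sgn (\<sigma> i) = \<epsilon> i"
  shows "gen_minimal_extrapolation n u
           (moments n u (\<lambda>A. \<Sum>i<s. \<sigma> i * dirac (x i) A))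
         = {\<lambda>A. \<Sum>i<s. \<sigma> i * dirac (x i) A}"
proof -
  define \<tau> where "\<tau> = (\<lambda>A. \<Sum>i<s. \<sigma> i * dirac (x i) A)"
  have x: "x i \<in> {-1..1}" if "i < s" for i using assms(4,5) that by blast
  have S: "finite S" "\<And>y. y \<in> S \<Longrightarrow> {y} \<in> sets borel_I"
    using assms(4,5) singleton_sets_borel_I by blast+
  have \<tau>: "finite_signed_measure borel_I \<tau>"
    unfolding \<tau>_def using x
    by (intro finite_signed_measure_weighted_sum finite_signed_measure_dirac) auto
  have \<tau>_off_S: "\<tau> B = 0" if "B \<in> sets borel_I" "B \<inter> S = {}" for B
    unfolding \<tau>_def using that assms(4) by (intro sum.neutral) (auto simp: dirac_eq indicator_def)
  have \<tau>_atom: "\<tau> {x i} = \<sigma> i" if "i < s" for i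
  proof -
    \<comment> \<open>Injectivity of \<open>x\<close> leaves \<open>j = i\<close> as the only
      contributing index.\<close>
    have "\<tau> {x i} = (\<Sum>j<s. if j = i then \<sigma> j else 0)"
      unfolding \<tau>_def using that assms(3) S(2) assms(4)
      by (intro sum.cong) (auto simp: dirac_eq inj_on_def indicator_def)
    then show ?thesis using that by simp
  qed
  have u: "u k \<in> borel_measurable borel_I" if "k \<le> n" for k
    using assms(2)[OF that] by (rule borel_measurable_borel_I)
  have "continuous_on {-1..1} P"
    unfolding assms(7) using assms(2) by (intro continuous_intros) auto
  then have P: "P \<in> borel_measurable borel_I" by (rule borel_measurable_borel_I)
  have P_le: "\<bar>P t\<bar> \<le> 1" if "t \<in> space borel_I" for t
  proof (cases "t \<in> S")
    case True
    then obtain i where "i < s" "t = x i" using assms(4) by auto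
    then show ?thesis using assms(6,9)[of i] by auto
  next
    case False
    then show ?thesis using assms(10)[of t] that by simp
  qed
  \<comment> \<open>Sums over points become sums over indices by injectivity of \<open>x\<close>.
    This serves \<tau> at once, and a competitor after it is shown to vanish off S.\<close>
  have integral_atoms: "signed_integral borel_I \<nu> f = (\<Sum>i<s. \<nu> {x i} * f (x i))"
    if "finite_signed_measure borel_I \<nu>" "f \<in> borel_measurable borel_I"
      "\<And>B. B \<in> sets borel_I \<Longrightarrow> B \<inter> S = {} \<Longrightarrow> \<nu> B = 0" for \<nu> f
    using signed_integral_concentrated[OF that(1) S that(3,2)] assms(3,4)
    by (simp add: sum.reindex mult.commute)
  have "\<sigma> i * P (x i) = \<bar>\<sigma> i\<bar>" if "i < s" for i
    using assms(9,11)[OF that] by (simp add: abs_sgn)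
  then have \<tau>_P: "signed_integral borel_I \<tau> P = (\<Sum>i<s. \<bar>\<sigma> i\<bar>)"
    using integral_atoms[OF \<tau> P \<tau>_off_S] by (simp add: \<tau>_atom)
  have "tv_norm borel_I \<tau> \<le> ennreal (\<Sum>i<s. \<bar>\<sigma> i\<bar>)"
    unfolding \<tau>_def using x by (intro tv_norm_dirac_sum_le) auto
  then have tv_\<tau>: "tv_norm borel_I \<tau> \<le> ennreal (signed_integral borel_I \<tau> P)"
    by (simp add: \<tau>_P)
  have same_integrals: "signed_integral borel_I \<nu> (u k) = signed_integral borel_I \<tau> (u k)"
    if "moments n u \<nu> = moments n u \<tau>" "k \<le> n" for \<nu> k
    using arg_cong[OF that(1), of "\<lambda>v. vec_index v k"] that(2) by (simp add: moments_def)
  \<comment> \<open>The integral of P is a fixed linear function of the moments, so it is the same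
    for all feasible measures.\<close>
  have P_expand: "signed_integral borel_I \<nu> P = (\<Sum>k\<le>n. a k * signed_integral borel_I \<nu> (u k))"
    if "finite_signed_measure borel_I \<nu>" for \<nu>
    unfolding assms(7)
    using finite_measure_positive_part[OF that] finite_measure_negative_part[OF that]
    by (intro signed_integral_linear_combination) (auto intro!: integrable_borel_I assms(2))
  have same_P: "signed_integral borel_I \<nu> P = signed_integral borel_I \<tau> P"
    if "finite_signed_measure borel_I \<nu>" "moments n u \<nu> = moments n u \<tau>" for \<nu>
    using P_expand[OF that(1)] P_expand[OF \<tau>] same_integrals[OF that(2)] by simp
  have minimal: "tv_norm borel_I \<tau> \<le> tv_norm borel_I \<nu>"
    if "finite_signed_measure borel_I \<nu>" "moments n u \<nu> = moments n u \<tau>" for \<nu>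
    using tv_\<tau> signed_integral_le_tv_norm[OF that(1) P P_le] same_P[OF that] by simp
  have unique: "\<nu> = \<tau>"
    if \<nu>: "finite_signed_measure borel_I \<nu>" and m: "moments n u \<nu> = moments n u \<tau>"
      and le: "tv_norm borel_I \<nu> \<le> tv_norm borel_I \<tau>" for \<nu>
  proof (rule ext)
    have "tv_norm borel_I \<nu> \<le> ennreal (signed_integral borel_I \<nu> P)"
      using le tv_\<tau> by (simp add: same_P[OF \<nu> m])
    moreover have "0 \<le> signed_integral borel_I \<nu> P"
      by (simp add: same_P[OF \<nu> m] \<tau>_P sum_nonneg)
    \<comment> \<open>A measurable set that misses S lies in the part of the interval where
      \<open>\<bar>P\<bar> < 1\<close>.\<close>
    ultimately have \<nu>_off_S: "\<nu> B = 0" if "B \<in> sets borel_I" "B \<inter> S = {}" for B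
      using that sets.sets_into_space[OF that(1)]
      by (intro signed_measure_eq_0_if_tv_norm_attained[OF \<nu> P P_le]) (auto intro!: assms(10))
    have "\<nu> {x i} = \<sigma> i" if "i < s" for i
    proof (rule gen_vandermonde_injective[OF assms(8) _ that])
      fix k assume "k \<le> n"
      \<comment> \<open>Both sides are the k-th moment, now a finite sum because both measures
        vanish off S.\<close>
      then show "(\<Sum>i<s. \<nu> {x i} * u k (x i)) = (\<Sum>i<s. \<sigma> i * u k (x i))"
        using integral_atoms[OF \<nu> u \<nu>_off_S] integral_atoms[OF \<tau> u \<tau>_off_S] same_integrals[OF m]
        by (simp add: \<tau>_atom)
    qed
    then have atoms: "\<nu> {y} = \<tau> {y}" if "y \<in> S" for y
      using that assms(4) \<tau>_atom by auto
    fix A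
    show "\<nu> A = \<tau> A"
    proof (cases "A \<in> sets borel_I")
      case True
      have "\<nu> A = (\<Sum>y\<in>S. indicator A y * \<nu> {y})"
        using \<nu> S \<nu>_off_S True by (rule signed_measure_concentrated)
      also have "\<dots> = (\<Sum>y\<in>S. indicator A y * \<tau> {y})"
        using atoms by (intro sum.cong) auto
      also have "\<dots> = \<tau> A"
        using \<tau> S \<tau>_off_S True by (rule signed_measure_concentrated[symmetric])
      finally show ?thesis .
    next
      \<comment> \<open>Outside \<open>sets borel_I\<close> both set functions are 0 by convention,
        which makes the equality one of functions on all sets.\<close>
      case False
      then show ?thesis using \<nu> \<tau> by (simp add: finite_signed_measure_def)
    qed
  qed
  have "gen_minimal_extrapolation n u (moments n u \<tau>) = {\<tau>}"
    unfolding gen_minimal_extrapolation_def using \<tau> minimal unique by blast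
  then show ?thesis by (simp add: \<tau>_def)
qed

end
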